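(* Let $Y$, $U$, $Q$ be real Banach spaces with $U$ reflexive, let $Z$ be a real Hilbert space, and let $U_{ad}\subset U$ be nonempty, closed and convex. Let $A\in\mathcal{B}(Y,Q)$ be boundedly invertible, $B\in\mathcal{B}(U,Q)$, $g\in Q$, $C\in\mathcal{B}(Y,Z)$, $z_d\in Z$. Let $M\in\mathcal{B}(Z,Z^* )$ be self-adjoint with $\langle Mz,z\rangle_{Z^*Z}\ge 0$ for all $z\in Z$, and let $\mathcal{Q}\in\mathcal{B}(U,U^* )$ be self-adjoint and coercive. For $y\in Y$, $u\in U$ set $$J(y,u)=\tfrac12\langle M(Cy-z_d),Cy-z_d\rangle_{Z^*Z}+\tfrac12\langle \mathcal{Q}u,u\rangle_{U^*U},$$ let $y(u):=A^{-1}(g-Bu)\in Y$ be the unique solution of the state equation $Ay+Bu-g=0$, and let $\tilde J(u):=J(y(u),u)$. Then there exists a unique minimizer $u\in U_{ad}$ of $\tilde J$ over $U_{ad}$, and for this $u$ there is a unique $p(u)\in Q^*$ such that $$\begin{aligned} Ay(u)+Bu&=g &&\text{in } Q,\\ C^*MCy(u)+A^*p(u)&=C^*Mz_d &&\text{in } Y^*,\\ \langle \mathcal{Q}u+B^*p(u),\tilde u-u\rangle_{U^*U}&\ge 0 &&\text{for all } \tilde u\in U_{ad}.\end{aligned}$$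
   Context: All linear spaces are real. $\mathcal{B}(H_1,H_2)$ denotes the space of bounded linear operators between normed spaces $H_1$ and $H_2$; $X^*$ is the topological dual of $X$ and $\langle\cdot,\cdot\rangle_{X^*X}$ the duality pairing. For $T\in\mathcal{B}(H_1,H_2)$, $T^*\in\mathcal{B}(H_2^*,H_1^* )$ is the Banach space adjoint, $\langle T^*f,x\rangle_{H_1^*H_1}=\langle f,Tx\rangle_{H_2^*H_2}$. An operator $T\in\mathcal{B}(X,X^* )$ is self-adjoint if $\langle Tx,x'\rangle_{X^*X}=\langle Tx',x\rangle_{X^*X}$ for all $x,x'\in X$, and coercive if there is $\lambda>0$ with $\langle Tx,x\rangle_{X^*X}\ge\lambda\|x\|_X^2$ for all $x\in X$. "Boundedly invertible" means bijective with bounded inverse. The space $Q$ and the operator $\mathcal{Q}$ are unrelated objects. The setting is that of a linear-quadratic optimal control problem: $J$ is to be minimized over pairs $(y,u)$ in the admissible set $Y\times U_{ad}$ satisfying the affine state equation $Ay+Bu-g=0$; equivalently, $\tilde J$ is to be minimized over $U_{ad}$. *)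

theory Defs
  imports "HOL-Analysis.Analysis"
begin

text \<open>The duality pairing of f in the dual of X with x in X is the application \<open>f x\<close>.\<close>

type_synonym 'a dual = "('a, real) blinfun"

lift_definition banach_adjoint ::
    "('a::real_normed_vector \<Rightarrow>\<^sub>L 'b::real_normed_vector) \<Rightarrow> ('b dual \<Rightarrow>\<^sub>L 'a dual)"
  is "\<lambda>T f. f o\<^sub>L T"
  by (rule bounded_bilinear.bounded_linear_left[OF bounded_bilinear_blinfun_compose])

lemma banach_adjoint_apply [simp]:
  "blinfun_apply (blinfun_apply (banach_adjoint T) f) x = blinfun_apply f (blinfun_apply T x)"
  by (simp add: banach_adjoint.rep_eq)

lift_definition bidual_embedding :: "'a::real_normed_vector \<Rightarrow> 'a dual dual"
  is "\<lambda>x f. blinfun_apply f x"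
  by (rule blinfun.bounded_linear_left)

definition reflexive_space :: "'a::real_normed_vector itself \<Rightarrow> bool" where
  "reflexive_space _ \<longleftrightarrow> surj (bidual_embedding :: 'a \<Rightarrow> 'a dual dual)"

definition boundedly_invertible ::
    "('a::real_normed_vector \<Rightarrow>\<^sub>L 'b::real_normed_vector) \<Rightarrow> bool" where
  "boundedly_invertible T \<longleftrightarrow> bij (blinfun_apply T) \<and> bounded_linear (inv (blinfun_apply T))"

definition self_adjoint_op :: "('a::real_normed_vector \<Rightarrow>\<^sub>L 'a dual) \<Rightarrow> bool" where
  "self_adjoint_op T \<longleftrightarrow> (\<forall>x x'. T x x' = T x' x)"

definition coercive_op :: "('a::real_normed_vector \<Rightarrow>\<^sub>L 'a dual) \<Rightarrow> bool" where
  "coercive_op T \<longleftrightarrow> (\<exists>c>0. \<forall>x. T x x \<ge> c * (norm x)\<^sup>2)"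

definition cost ::
    "('z::real_normed_vector \<Rightarrow>\<^sub>L 'z dual) \<Rightarrow> ('y::real_normed_vector \<Rightarrow>\<^sub>L 'z) \<Rightarrow> 'z \<Rightarrow>
     ('u::real_normed_vector \<Rightarrow>\<^sub>L 'u dual) \<Rightarrow> 'y \<Rightarrow> 'u \<Rightarrow> real" where
  "cost M C zd \<Q> y u = 1/2 * M (C y - zd) (C y - zd) + 1/2 * \<Q> u u"

definition state ::
    "('y::real_normed_vector \<Rightarrow>\<^sub>L 'q::real_normed_vector) \<Rightarrow>
     ('u::real_normed_vector \<Rightarrow>\<^sub>L 'q) \<Rightarrow> 'q \<Rightarrow> 'u \<Rightarrow> 'y" where
  "state A B g u = inv (blinfun_apply A) (g - B u)"

lemma state_eq_iff:
  fixes A :: "'y::real_normed_vector \<Rightarrow>\<^sub>L 'q::real_normed_vector"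
    and B :: "'u::real_normed_vector \<Rightarrow>\<^sub>L 'q"
  assumes "boundedly_invertible A"
  shows "A y + B u - g = 0 \<longleftrightarrow> y = state A B g u"
proof -
  have b: "bij (blinfun_apply A)"
    using assms by (simp add: boundedly_invertible_def)
  have "A y + B u - g = 0 \<longleftrightarrow> A y = g - B u"
    by (simp add: algebra_simps)
  also have "\<dots> \<longleftrightarrow> y = state A B g u"
    unfolding state_def using b by (metis bij_inv_eq_iff)
  finally show ?thesis .
qed

definition reduced_cost ::
    "('z::real_normed_vector \<Rightarrow>\<^sub>L 'z dual) \<Rightarrow> ('y::real_normed_vector \<Rightarrow>\<^sub>L 'z) \<Rightarrow> 'z \<Rightarrow>
     ('u::real_normed_vector \<Rightarrow>\<^sub>L 'u dual) \<Rightarrow>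
     ('y \<Rightarrow>\<^sub>L 'q::real_normed_vector) \<Rightarrow> ('u \<Rightarrow>\<^sub>L 'q) \<Rightarrow> 'q \<Rightarrow> 'u \<Rightarrow> real" where
  "reduced_cost M C zd \<Q> A B g u = cost M C zd \<Q> (state A B g u) u"

end

theory Submission
  imports Defs
begin

text \<open>
  Write \<open>f\<close> for the reduced cost. Since the state is an affine function of the control, \<open>f\<close> is a
  quadratic functional: along a line, \<open>f (u + t w) = f u + t D u w + t\<^sup>2 / 2 * E w\<close>, where \<open>E\<close> is the
  sum of the nonnegative form of the tracking term and the coercive form \<open>\<Q> w w\<close>
  (\<open>reduced_cost_expansion\<close>). Everything follows from this expansion.

  Existence and uniqueness: coercivity of \<open>E\<close> gives a uniform midpoint convexity estimate. It
  forces every minimizing sequence to be Cauchy, exactly as in the proof of the projection theorem in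
  Hilbert spaces, so by completeness the minimum is attained on a closed convex set
  (\<open>uniformly_convex_unique_arg_min\<close>).

  Optimality system: the adjoint equation says \<open>p \<circ> A = - M (C y - zd) \<circ> C\<close>, and as \<open>A\<close> is
  invertible this determines \<open>p\<close>. With this \<open>p\<close> the first derivative \<open>D u w\<close> is the
  pairing of \<open>\<Q> u + B\<^sup>* p\<close> with \<open>w\<close>, and at a minimizer over a convex set it is nonnegative in all
  admissible directions (\<open>arg_min_directional_derivative_nonneg\<close>).
\<close>

text \<open>The estimate at the midpoint bounds \<open>k * (norm (v - w))\<^sup>2\<close> by the mean excess of \<open>f v\<close> and
  \<open>f w\<close> over the infimum: two almost-minimizers are close to each other, and two minimizers are equal.\<close>

lemma uniformly_convex_unique_arg_min:
  fixes f :: "'a::banach \<Rightarrow> real"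
  assumes ne: "S \<noteq> {}" and cl: "closed S" and cv: "convex S"
    and cont: "continuous_on S f"
    and lower: "\<And>x. x \<in> S \<Longrightarrow> b \<le> f x"
    and k: "k > 0"
    and mid: "\<And>v w. v \<in> S \<Longrightarrow> w \<in> S \<Longrightarrow>
      f (midpoint v w) + k * (norm (v - w))\<^sup>2 \<le> (f v + f w) / 2"
  shows "\<exists>!x. is_arg_min f (\<lambda>v. v \<in> S) x"
proof -
  define m where "m = Inf (f ` S)"
  have bdd: "bdd_below (f ` S)"
    using lower by (intro bdd_belowI2)
  have m_le: "m \<le> f x" if "x \<in> S" for x
    unfolding m_def using bdd that by (intro cInf_lower) auto
  have midS: "midpoint v w \<in> S" if "v \<in> S" "w \<in> S" for v w
    using cv that by (meson closed_segment_subset midpoint_in_closed_segment subsetD)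
  have near: "k * (norm (v - w))\<^sup>2 \<le> (f v + f w) / 2 - m" if "v \<in> S" "w \<in> S" for v w
    using mid[OF that] m_le[OF midS[OF that]] by linarith
  have "\<exists>x\<in>S. f x < m + inverse (real (Suc n))" for n
    using cInf_lessD[of "f ` S" "m + inverse (real (Suc n))"] ne unfolding m_def by auto
  then obtain x where xS: "\<And>n. x n \<in> S" and x: "\<And>n. f (x n) < m + inverse (real (Suc n))"
    by metis
  have "Cauchy x"
  proof (rule metric_CauchyI)
    fix e :: real assume "e > 0"
    then obtain N where N: "inverse (real (Suc N)) < k * e\<^sup>2"
      using reals_Archimedean[of "k * e\<^sup>2"] k by auto
    have "dist (x i) (x j) < e" if "i \<ge> N" "j \<ge> N" for i j
    proof -
      have "inverse (real (Suc i)) \<le> inverse (real (Suc N))"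
           "inverse (real (Suc j)) \<le> inverse (real (Suc N))"
        using that by (auto intro: le_imp_inverse_le)
      then have "k * (norm (x i - x j))\<^sup>2 < k * e\<^sup>2"
        using near[OF xS[of i] xS[of j]] x[of i] x[of j] N by argo
      then have "(norm (x i - x j))\<^sup>2 < e\<^sup>2"
        using k by simp
      then show ?thesis
        using \<open>e > 0\<close> by (simp add: dist_norm power_less_imp_less_base)
    qed
    then show "\<exists>N. \<forall>i\<ge>N. \<forall>j\<ge>N. dist (x i) (x j) < e" by blast
  qed
  then obtain l where l: "x \<longlonglongrightarrow> l"
    using Cauchy_convergent convergent_def by blast
  have lS: "l \<in> S"
    using closed_sequentially[OF cl] xS l by blast
  have "(\<lambda>n. f (x n)) \<longlonglongrightarrow> f l"
    using cont l lS xS by (auto simp: continuous_on_sequentially o_def)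
  moreover have "(\<lambda>n. m + inverse (real (Suc n))) \<longlonglongrightarrow> m"
    using tendsto_add[OF tendsto_const LIMSEQ_inverse_real_of_nat, of m] by simp
  ultimately have "f l \<le> m"
    using x by (intro LIMSEQ_le[of "\<lambda>n. f (x n)"]) (auto intro: less_imp_le)
  then have "is_arg_min f (\<lambda>v. v \<in> S) l"
    using lS m_le by (fastforce simp: is_arg_min_def)
  moreover have "v = l" if v: "is_arg_min f (\<lambda>v. v \<in> S) v" for v
  proof -
    have vS: "v \<in> S" and "f v \<le> m"
      using v lS \<open>f l \<le> m\<close> by (fastforce simp: is_arg_min_def)+
    with near[OF vS lS] \<open>f l \<le> m\<close> have "k * (norm (v - l))\<^sup>2 \<le> 0"
      by argo
    then show ?thesis
      using k by (auto simp: mult_le_0_iff)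
  qed
  ultimately show ?thesis by blast
qed

text \<open>For a quadratic functional the defect in midpoint convexity is the second-order term at half
  of the difference, as in the parallelogram law.\<close>

lemma quadratic_midpoint_defect:
  fixes f :: "'a::real_vector \<Rightarrow> real"
  assumes quad: "\<And>u w t. f (u + t *\<^sub>R w) = f u + t * D u w + t\<^sup>2 / 2 * E w"
  shows "f (midpoint v w) + E ((1/2) *\<^sub>R (v - w)) / 2 = (f v + f w) / 2"
proof -
  let ?m = "midpoint v w" and ?h = "(1/2) *\<^sub>R (v - w)"
  have v: "?m + 1 *\<^sub>R ?h = v" and w: "?m + (-1) *\<^sub>R ?h = w"
    by (simp_all add: midpoint_def algebra_simps flip: scaleR_add_left)
  show ?thesis
    using quad[of ?m 1 ?h, unfolded v] quad[of ?m "-1" ?h, unfolded w] by simp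
qed

text \<open>Convexity keeps \<open>u + t (v - u)\<close> admissible for \<open>0 < t \<le> 1\<close>; dividing the growth of \<open>f\<close> by
  \<open>t\<close> and letting \<open>t\<close> tend to \<open>0\<close> leaves the first-order term.\<close>

lemma arg_min_directional_derivative_nonneg:
  fixes f :: "'a::real_vector \<Rightarrow> real"
  assumes cv: "convex S" and u: "is_arg_min f (\<lambda>v. v \<in> S) u" and v: "v \<in> S"
    and quad: "\<And>t. f (u + t *\<^sub>R (v - u)) = f u + t * d + t\<^sup>2 / 2 * e"
  shows "d \<ge> 0"
proof -
  have pos: "0 \<le> d + t / 2 * e" if t: "0 < t" "t \<le> 1" for t
  proof -
    have "(1 - t) *\<^sub>R u + t *\<^sub>R v \<in> S"
      using cv u v t by (auto simp: is_arg_min_def convex_alt)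
    then have "u + t *\<^sub>R (v - u) \<in> S"
      by (simp add: algebra_simps)
    then have "f u \<le> f (u + t *\<^sub>R (v - u))"
      using u by (fastforce simp: is_arg_min_def)
    then have "0 \<le> t * d + t\<^sup>2 / 2 * e"
      unfolding quad by simp
    also have "\<dots> = t * (d + t / 2 * e)"
      by (simp add: power2_eq_square algebra_simps)
    finally have "0 \<le> t * (d + t / 2 * e)" .
    then show ?thesis
      using t by (simp add: zero_le_mult_iff)
  qed
  have "((\<lambda>t. d + t / 2 * e) \<longlongrightarrow> d + 0 / 2 * e) (at_right 0)"
    by (intro tendsto_intros) auto
  moreover have "\<forall>\<^sub>F t in at_right 0. 0 \<le> d + t / 2 * e"
    unfolding eventually_at_right_field using pos by (intro exI[of _ 1]) auto
  ultimately show ?thesis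
    using tendsto_lowerbound[of "\<lambda>t. d + t / 2 * e" d "at_right 0" 0] by simp
qed

text \<open>The state moves by \<open>- t A\<^sup>-\<^sup>1 B w\<close>; self-adjointness of \<open>M\<close> and \<open>\<Q>\<close> merges the two mixed terms of each
  quadratic form into one.\<close>

lemma reduced_cost_expansion:
  fixes A :: "'y::real_normed_vector \<Rightarrow>\<^sub>L 'q::real_normed_vector"
    and B :: "'u::real_normed_vector \<Rightarrow>\<^sub>L 'q"
    and C :: "'y \<Rightarrow>\<^sub>L 'z::real_normed_vector"
  assumes A: "boundedly_invertible A"
    and M: "self_adjoint_op M" and Q: "self_adjoint_op \<Q>"
  defines "R \<equiv> \<lambda>w. C (inv (blinfun_apply A) (B w))"
  shows "reduced_cost M C zd \<Q> A B g (u + t *\<^sub>R w) = reduced_cost M C zd \<Q> A B g u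
    + t * (\<Q> u w - M (C (state A B g u) - zd) (R w))
    + t\<^sup>2 / 2 * (M (R w) (R w) + \<Q> w w)"
proof -
  interpret inv: bounded_linear "inv (blinfun_apply A)"
    using A by (simp add: boundedly_invertible_def)
  define r where "r = C (state A B g u) - zd"
  have "C (state A B g (u + t *\<^sub>R w)) - zd = r - t *\<^sub>R R w"
    by (simp add: state_def r_def R_def inv.add inv.diff inv.scaleR
        blinfun.add_right blinfun.diff_right blinfun.scaleR_right algebra_simps)
  then have "reduced_cost M C zd \<Q> A B g (u + t *\<^sub>R w)
      = 1/2 * M (r - t *\<^sub>R R w) (r - t *\<^sub>R R w) + 1/2 * \<Q> (u + t *\<^sub>R w) (u + t *\<^sub>R w)"
    by (simp only: reduced_cost_def cost_def)
  moreover have "reduced_cost M C zd \<Q> A B g u = 1/2 * M r r + 1/2 * \<Q> u u"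
    by (simp only: reduced_cost_def cost_def r_def)
  moreover have "M (R w) r = M r (R w)" "\<Q> w u = \<Q> u w"
    using M Q by (auto simp: self_adjoint_op_def)
  ultimately show ?thesis
    unfolding r_def[symmetric]
    by (simp add: blinfun.add_right blinfun.diff_right blinfun.scaleR_right
        blinfun.add_left blinfun.diff_left blinfun.scaleR_left power2_eq_square algebra_simps)
qed

lemma continuous_reduced_cost:
  fixes A :: "'y::real_normed_vector \<Rightarrow>\<^sub>L 'q::real_normed_vector"
    and B :: "'u::real_normed_vector \<Rightarrow>\<^sub>L 'q"
  assumes A: "boundedly_invertible A"
  shows "continuous_on S (reduced_cost M C zd \<Q> A B g)"
proof -
  interpret inv: bounded_linear "inv (blinfun_apply A)"
    using A by (simp add: boundedly_invertible_def)
  show ?thesis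
    unfolding reduced_cost_def cost_def state_def
    by (intro continuous_intros inv.continuous_on)
qed

text \<open>Inverting \<open>A\<close> and taking adjoints commute, so the adjoint equation has exactly one solution,
  given in closed form.\<close>

lemma banach_adjoint_eq_iff:
  fixes A :: "'y::real_normed_vector \<Rightarrow>\<^sub>L 'q::real_normed_vector"
  assumes A: "boundedly_invertible A"
  shows "banach_adjoint A p = f \<longleftrightarrow> p = f o\<^sub>L Blinfun (inv (blinfun_apply A))"
proof -
  have bij: "bij (blinfun_apply A)" and bl: "bounded_linear (inv (blinfun_apply A))"
    using A by (simp_all add: boundedly_invertible_def)
  show ?thesis
  proof
    assume "banach_adjoint A p = f"
    then have "f y = p (A y)" for y by auto
    then show "p = f o\<^sub>L Blinfun (inv (blinfun_apply A))"
      using bij by (intro blinfun_eqI)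
        (simp add: bounded_linear_Blinfun_apply[OF bl] bij_is_surj surj_f_inv_f)
  next
    assume "p = f o\<^sub>L Blinfun (inv (blinfun_apply A))"
    then show "banach_adjoint A p = f"
      using bij by (intro blinfun_eqI)
        (simp add: bounded_linear_Blinfun_apply[OF bl] bij_is_inj)
  qed
qed

theorem mainTheorem1:
  fixes A :: "'y::banach \<Rightarrow>\<^sub>L 'q::banach"
    and B :: "'u::banach \<Rightarrow>\<^sub>L 'q"
    and g :: 'q
    and C :: "'y \<Rightarrow>\<^sub>L 'z::{real_inner, banach}"
    and zd :: 'z
    and M :: "'z \<Rightarrow>\<^sub>L 'z dual"
    and \<Q> :: "'u \<Rightarrow>\<^sub>L 'u dual"
    and Uad :: "'u set"
  assumes "reflexive_space TYPE('u)"
    and "Uad \<noteq> {}" and "closed Uad" and "convex Uad"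
    and "boundedly_invertible A"
    and "self_adjoint_op M" and "\<And>z. M z z \<ge> 0"
    and "self_adjoint_op \<Q>" and "coercive_op \<Q>"
  shows "(\<exists>!u. is_arg_min (reduced_cost M C zd \<Q> A B g) (\<lambda>v. v \<in> Uad) u) \<and>
    (\<forall>u. is_arg_min (reduced_cost M C zd \<Q> A B g) (\<lambda>v. v \<in> Uad) u \<longrightarrow>
      (\<exists>!p :: 'q dual.
          A (state A B g u) + B u = g \<and>
          banach_adjoint C (M (C (state A B g u))) + banach_adjoint A p
            = banach_adjoint C (M zd) \<and>
          (\<forall>v\<in>Uad. (\<Q> u + banach_adjoint B p) (v - u) \<ge> 0)))"
proof -
  let ?f = "reduced_cost M C zd \<Q> A B g"
  let ?R = "\<lambda>w. C (inv (blinfun_apply A) (B w))"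
  let ?E = "\<lambda>w. M (?R w) (?R w) + \<Q> w w"
  note expand = reduced_cost_expansion[OF assms(5,6,8)]
  have bl: "bounded_linear (inv (blinfun_apply A))"
    using assms(5) by (simp add: boundedly_invertible_def)
  obtain c where c: "c > 0" and coer: "\<And>w. c * (norm w)\<^sup>2 \<le> \<Q> w w"
    using assms(9) by (auto simp: coercive_op_def)
  have "\<exists>!u. is_arg_min ?f (\<lambda>v. v \<in> Uad) u"
  proof (rule uniformly_convex_unique_arg_min[OF assms(2-4)])
    show "continuous_on Uad ?f"
      by (rule continuous_reduced_cost[OF assms(5)])
    show "0 \<le> ?f v" for v
    proof -
      have "0 \<le> \<Q> v v" using coer[of v] c by (smt (verit) mult_nonneg_nonneg zero_le_power2)
      then show ?thesis
        using assms(7)[of "C (state A B g v) - zd"] by (simp add: reduced_cost_def cost_def)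
    qed
    (* E is quadratic: halving v - w gives a factor 1/4, and the midpoint defect is half of E. *)
    show "c / 8 > 0" using c by simp
    show "?f (midpoint v w) + c / 8 * (norm (v - w))\<^sup>2 \<le> (?f v + ?f w) / 2" for v w
    proof -
      have "c / 4 * (norm (v - w))\<^sup>2 \<le> ?E ((1/2) *\<^sub>R (v - w))"
        using coer[of "(1/2) *\<^sub>R (v - w)"] assms(7)[of "?R ((1/2) *\<^sub>R (v - w))"]
        by (simp add: power_divide)
      then show ?thesis
        using quadratic_midpoint_defect[of ?f _ ?E v w, OF expand] by argo
    qed
  qed
  moreover have "\<exists>!p. A (state A B g u) + B u = g \<and>
      banach_adjoint C (M (C (state A B g u))) + banach_adjoint A p = banach_adjoint C (M zd) \<and>
      (\<forall>v\<in>Uad. (\<Q> u + banach_adjoint B p) (v - u) \<ge> 0)"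
    if u: "is_arg_min ?f (\<lambda>v. v \<in> Uad) u" for u
  proof -
    let ?y = "state A B g u"
    define p where "p = (banach_adjoint C (M zd) - banach_adjoint C (M (C ?y)))
      o\<^sub>L Blinfun (inv (blinfun_apply A))"
    have state: "A ?y + B u = g"
      using state_eq_iff[OF assms(5), of ?y B u g] by simp
    have adjoint_eq: "banach_adjoint C (M (C ?y)) + banach_adjoint A p'
        = banach_adjoint C (M zd) \<longleftrightarrow> p' = p" for p'
      unfolding p_def banach_adjoint_eq_iff[OF assms(5), symmetric] by (auto simp: algebra_simps)
    have gradient: "(\<Q> u + banach_adjoint B p) w = \<Q> u w - M (C ?y - zd) (?R w)" for w
      by (simp add: p_def bounded_linear_Blinfun_apply[OF bl] blinfun.add_left
          blinfun.diff_left blinfun.diff_right)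
    have "(\<Q> u + banach_adjoint B p) (v - u) \<ge> 0" if "v \<in> Uad" for v
      unfolding gradient
      by (rule arg_min_directional_derivative_nonneg[OF assms(4) u that expand])
    then show ?thesis
      unfolding adjoint_eq using state by (intro ex1I[of _ p]) auto
  qed
  ultimately show ?thesis by blast
qed

end
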